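(* Let $\varphi$ and $\psi$ be differentiable involutions of $[\tau_1,\tau_2]$ and $[\sigma_1,\sigma_2]$ respectively ($\tau_1<\tau_2$, $\sigma_1<\sigma_2$), and let $f:[\sigma_1,\sigma_2]\to[\tau_1,\tau_2]$ be an orientation-preserving diffeomorphism with $f(\psi(s))=\varphi(f(s))$ for all $s\in[\sigma_1,\sigma_2]$. Let $a,b,c,d\in L^1([\tau_1,\tau_2])$ and let $h$ be a given function on $[\tau_1,\tau_2]$. Then the problem $$d(t)x'(t)+c(t)x'(\varphi(t))+b(t)x(t)+a(t)x(\varphi(t))=h(t),\quad t\in[\tau_1,\tau_2],\qquad x(\tau_1)=x(\tau_2),$$ is equivalent to the problem $$\frac{d(f(s))}{f'(s)}\,y'(s)+\frac{c(f(s))}{f'(\psi(s))}\,y'(\psi(s))+b(f(s))\,y(s)+a(f(s))\,y(\psi(s))=h(f(s)),\quad s\in[\sigma_1,\sigma_2],\qquad y(\sigma_1)=y(\sigma_2),$$ in the sense that $x$ is a solution of the first problem if and only if $y:=x\circ f$ is a solution of the second.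
   Context: An involution is a function $\varphi$ from a set to itself, different from the identity, with $\varphi\circ\varphi=\mathrm{id}$. A diffeomorphism here is a differentiable bijection with differentiable inverse; orientation-preserving means increasing. Solutions are absolutely continuous functions satisfying the equation almost everywhere and the boundary condition. *)

theory Defs
  imports "HOL-Analysis.Analysis"
begin

(* Functions on an interval are total functions real => real of which only the values on the
   interval matter. Hence all derivatives are taken within the interval (one-sided at its end
   points). *)

definition involution_on :: "'a set \<Rightarrow> ('a \<Rightarrow> 'a) \<Rightarrow> bool" where
  "involution_on S \<phi> \<longleftrightarrow>
     \<phi> ` S \<subseteq> S \<and> (\<forall>t\<in>S. \<phi> (\<phi> t) = t) \<and> (\<exists>t\<in>S. \<phi> t \<noteq> t)"

definition diffeomorphism_on :: "real set \<Rightarrow> real set \<Rightarrow> (real \<Rightarrow> real) \<Rightarrow> bool" where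
  "diffeomorphism_on S T f \<longleftrightarrow>
     bij_betw f S T \<and> f differentiable_on S \<and> inv_into S f differentiable_on T"

(* The library's absolutely_continuous is a relation between measures; this is the usual
   epsilon-delta notion for functions. A pair (u, v) stands for the interval from u to v. *)
definition absolutely_continuous_fun :: "real \<Rightarrow> real \<Rightarrow> (real \<Rightarrow> real) \<Rightarrow> bool" where
  "absolutely_continuous_fun l r x \<longleftrightarrow>
     (\<forall>\<epsilon>>0. \<exists>\<delta>>0. \<forall>D :: (real \<times> real) set.
        finite D \<and> (\<forall>(u, v)\<in>D. l \<le> u \<and> u \<le> v \<and> v \<le> r)
        \<and> disjoint_family_on (\<lambda>(u, v). {u<..<v}) D
        \<and> (\<Sum>(u, v)\<in>D. v - u) < \<delta>
        \<longrightarrow> (\<Sum>(u, v)\<in>D. \<bar>x v - x u\<bar>) < \<epsilon>)"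

abbreviation deriv_within :: "real set \<Rightarrow> (real \<Rightarrow> real) \<Rightarrow> real \<Rightarrow> real" where
  "deriv_within S x t \<equiv> vector_derivative x (at t within S)"

(* x solves  d(t) x'(t) + c(t) x'(\<phi>(t)) + b(t) x(t) + a(t) x(\<phi>(t)) = h(t),  x(l) = x(r).
   vector_derivative is total, so the existence of the derivatives occurring in the equation
   at t is made part of the equation holding at t. *)
definition solves_periodic_problem ::
  "real \<Rightarrow> real \<Rightarrow> (real \<Rightarrow> real) \<Rightarrow> (real \<Rightarrow> real) \<Rightarrow> (real \<Rightarrow> real) \<Rightarrow> (real \<Rightarrow> real)
    \<Rightarrow> (real \<Rightarrow> real) \<Rightarrow> (real \<Rightarrow> real) \<Rightarrow> (real \<Rightarrow> real) \<Rightarrow> bool" where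
  "solves_periodic_problem l r \<phi> d c b a h x \<longleftrightarrow>
     absolutely_continuous_fun l r x
     \<and> (AE t in lebesgue_on {l..r}.
          x differentiable (at t within {l..r})
          \<and> x differentiable (at (\<phi> t) within {l..r})
          \<and> d t * deriv_within {l..r} x t + c t * deriv_within {l..r} x (\<phi> t)
              + b t * x t + a t * x (\<phi> t) = h t)
     \<and> x l = x r"

end

theory Submission
  imports Defs
begin

text \<open>An everywhere differentiable monotone function is absolutely continuous, even when its
  derivative is unbounded: the derivative is nonnegative and has an integral, so it is Lebesgue
  integrable. Precomposing with \<open>f\<close> or with its inverse therefore preserves absolute continuity,
  and it preserves null sets because both maps are differentiable. At every point the product of the
  derivatives of \<open>f\<close> and its inverse is 1, so the chain rule turns one equation at \<open>f s\<close> into the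
  other at \<open>s\<close>.\<close>

section \<open>Absolute continuity of monotone differentiable functions\<close>

lemma mono_on_has_vector_derivative_nonneg:
  fixes f :: "real \<Rightarrow> real"
  assumes "l < r" "t \<in> {l..r}" "mono_on {l..r} f"
    and "(f has_vector_derivative D) (at t within {l..r})"
  shows "0 \<le> D"
proof (rule tendsto_lowerbound)
  show "((\<lambda>y. (f y - f t) / (y - t)) \<longlongrightarrow> D) (at t within {l..r})"
    using assms(4) by (simp add: has_field_derivative_iff flip: has_real_derivative_iff_has_vector_derivative)
  have "0 \<le> (f y - f t) / (y - t)" if "y \<in> {l..r}" for y
  proof (cases y t rule: linorder_le_cases)
    case le
    then show ?thesis
      using mono_onD[OF assms(3) that assms(2)] by (simp add: divide_nonpos_nonpos)
  next
    case ge
    then show ?thesis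
      using mono_onD[OF assms(3) assms(2) that] by simp
  qed
  then show "\<forall>\<^sub>F y in at t within {l..r}. 0 \<le> (f y - f t) / (y - t)"
    by (auto simp: eventually_at_filter)
  \<comment> \<open>Since \<open>l < r\<close>, every point of the interval, end points included, is
    a limit point of it, so the limit of the difference quotients is not vacuous.\<close>
  show "at t within {l..r} \<noteq> bot"
    using assms(1,2) by (simp add: trivial_limit_within)
qed

text \<open>A common point of the closed intervals that is none of the four end points would lie in
  both open ones. This passes from disjoint interiors, as in absolute continuity, to closed
  intervals, over which integrals are taken.\<close>

lemma negligible_Icc_Int_Icc:
  fixes u v u' v' :: real
  assumes "{u<..<v} \<inter> {u'<..<v'} = {}"
  shows "negligible ({u..v} \<inter> {u'..v'})"
proof (rule negligible_subset)
  show "negligible {u, v, u', v'}"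
    by simp
  show "{u..v} \<inter> {u'..v'} \<subseteq> {u, v, u', v'}"
    using assms by (force simp: disjoint_iff)
qed

text \<open>Isolates the conditions on families in \<open>absolutely_continuous_fun\<close> from the
  bound on total length, since a change of variable preserves the former and alters the latter.
  Intervals may share end points or be degenerate.\<close>

definition nonoverlapping_in :: "real \<Rightarrow> real \<Rightarrow> (real \<times> real) set \<Rightarrow> bool" where
  "nonoverlapping_in l r D \<longleftrightarrow>
     finite D \<and> (\<forall>(u, v)\<in>D. l \<le> u \<and> u \<le> v \<and> v \<le> r)
     \<and> disjoint_family_on (\<lambda>(u, v). {u<..<v}) D"

lemma nonoverlapping_inD:
  assumes "nonoverlapping_in l r D"
  shows "finite D" "\<forall>(u, v)\<in>D. l \<le> u \<and> u \<le> v \<and> v \<le> r"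
    "disjoint_family_on (\<lambda>(u, v). {u<..<v}) D"
  using assms by (auto simp: nonoverlapping_in_def)

lemma absolutely_continuous_fun_iff:
  "absolutely_continuous_fun l r x \<longleftrightarrow>
     (\<forall>\<epsilon>>0. \<exists>\<delta>>0. \<forall>D. nonoverlapping_in l r D \<longrightarrow> (\<Sum>(u, v)\<in>D. v - u) < \<delta>
        \<longrightarrow> (\<Sum>(u, v)\<in>D. \<bar>x v - x u\<bar>) < \<epsilon>)"
  unfolding absolutely_continuous_fun_def nonoverlapping_in_def
  by (simp only: conj_assoc imp_conjL)

lemma absolutely_continuous_funE:
  assumes "absolutely_continuous_fun l r x" "\<epsilon> > 0"
  obtains \<delta> where "\<delta> > 0"
    "\<And>D. nonoverlapping_in l r D \<Longrightarrow> (\<Sum>(u, v)\<in>D. v - u) < \<delta>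
        \<Longrightarrow> (\<Sum>(u, v)\<in>D. \<bar>x v - x u\<bar>) < \<epsilon>"
proof -
  have "\<exists>\<delta>>0. \<forall>D. nonoverlapping_in l r D \<longrightarrow> (\<Sum>(u, v)\<in>D. v - u) < \<delta>
        \<longrightarrow> (\<Sum>(u, v)\<in>D. \<bar>x v - x u\<bar>) < \<epsilon>"
    using assms by (simp only: absolutely_continuous_fun_iff)
  then show thesis
    using that by (elim exE conjE) simp
qed

text \<open>Truncation argument: the derivative \<open>g\<close> is cut at height \<open>n\<close>.
  The part below the cut contributes at most \<open>n\<close> times the total length of the family;
  the excess \<open>q n\<close> has an arbitrarily small integral over the whole interval once
  \<open>n\<close> is large.\<close>

lemma absolutely_continuous_fun_mono_differentiable:
  fixes f :: "real \<Rightarrow> real"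
  assumes "l < r" "mono_on {l..r} f" "f differentiable_on {l..r}"
  shows "absolutely_continuous_fun l r f"
  unfolding absolutely_continuous_fun_iff
proof (intro allI impI)
  fix \<epsilon> :: real
  assume "\<epsilon> > 0"
  define g where "g = deriv_within {l..r} f"
  define q where "q n t = g t - min (g t) (real n)" for n t
  have der: "(f has_vector_derivative g t) (at t within {l..r})" if "t \<in> {l..r}" for t
    unfolding g_def
    using assms(3) that by (simp add: differentiable_on_def flip: vector_derivative_works)
  have g_nonneg: "0 \<le> g t" if "t \<in> {l..r}" for t
    using mono_on_has_vector_derivative_nonneg[OF assms(1) that assms(2) der[OF that]] .
  \<comment> \<open>The gauge integral recovers increments from any derivative that exists
    everywhere, bounded or not. Nonnegativity of \<open>g\<close> then upgrades this to absolute
    integrability.\<close>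
  have g_int: "(g has_integral (f v - f u)) {u..v}" if "l \<le> u" "u \<le> v" "v \<le> r" for u v
  proof (rule fundamental_theorem_of_calculus)
    show "(f has_vector_derivative g t) (at t within {u..v})" if "t \<in> {u..v}" for t
      using der[of t] \<open>l \<le> u\<close> \<open>v \<le> r\<close> that by (auto intro: has_vector_derivative_within_subset)
  qed fact
  have g_abs: "g absolutely_integrable_on {l..r}"
    using g_int[of l r] assms(1) g_nonneg
    by (intro nonnegative_absolutely_integrable_1) auto
  have min_int: "(\<lambda>t. min (g t) (real n)) integrable_on {l..r}" for n
    using absolutely_integrable_min_1[OF g_abs, of "\<lambda>_. real n"]
    by (auto intro: set_lebesgue_integral_eq_integral(1))
  have q_int: "q n integrable_on {u..v}" if "l \<le> u" "v \<le> r" for n u v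
  proof (rule integrable_subinterval_real)
    show "q n integrable_on {l..r}"
      unfolding q_def using g_int[of l r] assms(1) min_int by (intro integrable_diff) auto
  qed (use that in auto)
  have q_nonneg: "0 \<le> q n t" for n t
    by (simp add: q_def)
  \<comment> \<open>Each \<open>q n t\<close> vanishes as soon as \<open>n\<close> exceeds
    \<open>g t\<close>, and \<open>g\<close> itself is the integrable majorant.\<close>
  have "(\<lambda>n. integral {l..r} (q n)) \<longlonglongrightarrow> integral {l..r} (\<lambda>_. 0)"
  proof (rule dominated_convergence(2))
    show "g integrable_on {l..r}"
      using g_int[of l r] assms(1) by auto
    show "norm (q n t) \<le> g t" if "t \<in> {l..r}" for n t
      using g_nonneg[OF that] by (auto simp: q_def)
    show "(\<lambda>n. q n t) \<longlonglongrightarrow> 0" if "t \<in> {l..r}" for t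
    proof (rule tendsto_eventually)
      obtain n where "g t \<le> real n"
        using real_arch_simple by blast
      then show "\<forall>\<^sub>F n in sequentially. q n t = 0"
        by (auto simp: q_def eventually_sequentially intro!: exI[of _ n])
    qed
  qed (use q_int in auto)
  then have "\<forall>\<^sub>F n in sequentially. integral {l..r} (q n) < \<epsilon> / 2"
    using \<open>\<epsilon> > 0\<close> by (intro order_tendstoD) auto
  then obtain n where n: "integral {l..r} (q n) < \<epsilon> / 2"
    by (auto simp: eventually_sequentially)
  \<comment> \<open>Half of \<epsilon> is spent on the excess and half on \<open>n\<close> times the
    total length; the \<open>+ 1\<close> keeps the denominator positive when \<open>n\<close> is
    0.\<close>
  define \<delta> where "\<delta> = \<epsilon> / (2 * (real n + 1))"
  have "\<delta> > 0"
    using \<open>\<epsilon> > 0\<close> by (simp add: \<delta>_def)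
  have g_le: "g t \<le> q n t + real n" for t
    by (simp add: q_def)
  have incr: "f v - f u \<le> integral {u..v} (q n) + real n * (v - u)"
    if "l \<le> u" "u \<le> v" "v \<le> r" for u v
  proof -
    have "f v - f u = integral {u..v} g"
      using g_int[OF that] by (simp add: integral_unique)
    also have "\<dots> \<le> integral {u..v} (\<lambda>t. q n t + real n)"
      using g_int[OF that] q_int[OF that(1,3)] g_le by (intro integral_le integrable_add) auto
    also have "\<dots> = integral {u..v} (q n) + real n * (v - u)"
      using q_int[OF that(1,3)] that(2) by (subst integral_add) auto
    finally show ?thesis .
  qed
  have "(\<Sum>(u, v)\<in>D. \<bar>f v - f u\<bar>) < \<epsilon>"
    if nonoverlap: "nonoverlapping_in l r D" and small: "(\<Sum>(u, v)\<in>D. v - u) < \<delta>" for D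
  proof -
    note D = nonoverlapping_inD[OF nonoverlap]
    \<comment> \<open>The closed intervals overlap only in null sets, so the sum of the integrals is
      one integral over the union; as \<open>q n\<close> is nonnegative, it is at most the integral
      over \<open>{l..r}\<close>.\<close>
    have q_UN: "(q n has_integral (\<Sum>(u, v)\<in>D. integral {u..v} (q n))) (\<Union>(u, v)\<in>D. {u..v})"
    proof (rule has_integral_UN[OF D(1)])
      show "(q n has_integral (case p of (u, v) \<Rightarrow> integral {u..v} (q n)))
          (case p of (u, v) \<Rightarrow> {u..v})" if "p \<in> D" for p
        using bspec[OF D(2) that] q_int by (cases p) (auto intro: integrable_integral)
      show "pairwise (\<lambda>p p'. negligible ((case p of (u, v) \<Rightarrow> {u..v}) \<inter> (case p' of (u, v) \<Rightarrow> {u..v}))) D"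
        using D(3) by (fastforce simp: pairwise_def disjoint_family_on_def intro: negligible_Icc_Int_Icc)
    qed
    have "(\<Sum>(u, v)\<in>D. \<bar>f v - f u\<bar>) \<le> (\<Sum>(u, v)\<in>D. integral {u..v} (q n) + real n * (v - u))"
      using D(2) incr mono_onD[OF assms(2)] by (intro sum_mono) fastforce
    also have "\<dots> = (\<Sum>(u, v)\<in>D. integral {u..v} (q n)) + real n * (\<Sum>(u, v)\<in>D. v - u)"
      by (simp add: sum.distrib sum_distrib_left case_prod_unfold)
    also have "(\<Sum>(u, v)\<in>D. integral {u..v} (q n)) \<le> integral {l..r} (q n)"
    proof (rule has_integral_subset_le[OF _ q_UN])
      show "(\<Union>(u, v)\<in>D. {u..v}) \<subseteq> {l..r}"
        using D(2) by fastforce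
    qed (use q_int q_nonneg in auto)
    also have "real n * (\<Sum>(u, v)\<in>D. v - u) \<le> real n * \<delta>"
      using small by (intro mult_left_mono) auto
    also have "real n * \<delta> \<le> \<epsilon> / 2"
      using \<open>\<epsilon> > 0\<close> by (simp add: \<delta>_def field_simps)
    finally show ?thesis
      using n by simp
  qed
  with \<open>\<delta> > 0\<close> show "\<exists>\<delta>>0. \<forall>D. nonoverlapping_in l r D \<longrightarrow> (\<Sum>(u, v)\<in>D. v - u) < \<delta>
      \<longrightarrow> (\<Sum>(u, v)\<in>D. \<bar>f v - f u\<bar>) < \<epsilon>"
    by blast
qed

section \<open>Absolute continuity under an increasing change of variable\<close>

lemma absolutely_continuous_fun_cong:
  assumes "\<And>t. t \<in> {l..r} \<Longrightarrow> x t = y t"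
  shows "absolutely_continuous_fun l r x \<longleftrightarrow> absolutely_continuous_fun l r y"
proof -
  have "(\<Sum>(u, v)\<in>D. \<bar>x v - x u\<bar>) = (\<Sum>(u, v)\<in>D. \<bar>y v - y u\<bar>)" if "nonoverlapping_in l r D" for D
  proof (rule sum.cong)
    fix p
    assume "p \<in> D"
    then show "(case p of (u, v) \<Rightarrow> \<bar>x v - x u\<bar>) = (case p of (u, v) \<Rightarrow> \<bar>y v - y u\<bar>)"
      using bspec[OF nonoverlapping_inD(2)[OF that], of p] assms by (cases p) simp
  qed simp
  then show ?thesis
    by (simp add: absolutely_continuous_fun_iff cong: imp_cong)
qed

text \<open>The tolerance \<epsilon> for \<open>x\<close> yields \<eta>, which serves as the
  tolerance for \<open>f\<close>. Monotonicity makes \<open>f\<close> carry nonoverlapping families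
  to nonoverlapping families, and the length of the image family is the variation of
  \<open>f\<close> over the original one.\<close>

lemma absolutely_continuous_fun_compose:
  fixes f x :: "real \<Rightarrow> real"
  assumes f: "strict_mono_on {l..r} f" "f ` {l..r} = {l'..r'}" "absolutely_continuous_fun l r f"
    and x: "absolutely_continuous_fun l' r' x"
  shows "absolutely_continuous_fun l r (x \<circ> f)"
  unfolding absolutely_continuous_fun_iff
proof (intro allI impI)
  fix \<epsilon> :: real
  assume "\<epsilon> > 0"
  then obtain \<eta> where "\<eta> > 0" and \<eta>: "\<And>D. nonoverlapping_in l' r' D \<Longrightarrow> (\<Sum>(u, v)\<in>D. v - u) < \<eta>
      \<Longrightarrow> (\<Sum>(u, v)\<in>D. \<bar>x v - x u\<bar>) < \<epsilon>"
    using absolutely_continuous_funE[OF x] by blast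
  obtain \<delta> where "\<delta> > 0" and \<delta>: "\<And>D. nonoverlapping_in l r D \<Longrightarrow> (\<Sum>(u, v)\<in>D. v - u) < \<delta>
      \<Longrightarrow> (\<Sum>(u, v)\<in>D. \<bar>f v - f u\<bar>) < \<eta>"
    using absolutely_continuous_funE[OF f(3) \<open>\<eta> > 0\<close>] by blast
  have le_iff: "f u \<le> f v \<longleftrightarrow> u \<le> v" if "u \<in> {l..r}" "v \<in> {l..r}" for u v
    using strict_mono_on_leD[OF f(1)] strict_mono_onD[OF f(1)] that by (meson leD linorder_le_less_linear)
  have "(\<Sum>(u, v)\<in>D. \<bar>(x \<circ> f) v - (x \<circ> f) u\<bar>) < \<epsilon>"
    if nonoverlap: "nonoverlapping_in l r D" and small: "(\<Sum>(u, v)\<in>D. v - u) < \<delta>" for D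
  proof -
    note D = nonoverlapping_inD[OF nonoverlap]
    have D_Icc: "u \<in> {l..r}" "v \<in> {l..r}" "u \<le> v" if "(u, v) \<in> D" for u v
      using D(2) that by fastforce+
    \<comment> \<open>Distinct pairs must keep distinct images, so that sums over the image family
      can be reindexed over \<open>D\<close>.\<close>
    have inj: "inj_on (map_prod f f) D"
    proof (rule inj_on_subset)
      show "inj_on (map_prod f f) ({l..r} \<times> {l..r})"
        using strict_mono_on_imp_inj_on[OF f(1)] by (intro map_prod_inj_on)
    qed (use D_Icc in auto)
    have "(\<Sum>(u, v)\<in>map_prod f f ` D. \<bar>x v - x u\<bar>) < \<epsilon>"
    proof (rule \<eta>)
      have bounds: "l' \<le> f u \<and> f u \<le> f v \<and> f v \<le> r'" if "(u, v) \<in> D" for u v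
      proof -
        have "f u \<in> {l'..r'}" "f v \<in> {l'..r'}" "f u \<le> f v"
          using D_Icc[OF that] le_iff by (auto simp flip: f(2))
        then show ?thesis
          by simp
      qed
      \<comment> \<open>A common point of two image intervals has a preimage \<open>z\<close> by
        surjectivity; since \<open>f\<close> also reflects the order, \<open>z\<close> would lie in
        both original intervals.\<close>
      have disj: "{f u<..<f v} \<inter> {f u'<..<f v'} = {}"
        if uv: "(u, v) \<in> D" "(u', v') \<in> D" "(u, v) \<noteq> (u', v')" for u v u' v'
      proof (rule ccontr)
        assume "\<not> ?thesis"
        then obtain y where "y \<in> {f u<..<f v} \<inter> {f u'<..<f v'}"
          by blast
        then have y: "f u < y" "y < f v" "f u' < y" "y < f v'"
          by simp_all
        then have "y \<in> {l'..r'}"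
          using bounds[OF uv(1)] by simp
        then obtain z where "z \<in> {l..r}" "y = f z"
          unfolding f(2)[symmetric] by blast
        then have "z \<in> {u<..<v} \<inter> {u'<..<v'}"
          using y le_iff D_Icc[OF uv(1)] D_Icc[OF uv(2)] by (auto simp flip: not_le)
        moreover have "{u<..<v} \<inter> {u'<..<v'} = {}"
          using disjoint_family_onD[OF D(3) uv] by simp
        ultimately show False
          by blast
      qed
      have "disjoint_family_on (\<lambda>(u, v). {u<..<v}) (map_prod f f ` D)"
        unfolding disjoint_family_on_def
      proof (intro ballI impI)
        fix p p'
        assume "p \<in> map_prod f f ` D" "p' \<in> map_prod f f ` D" "p \<noteq> p'"
        then obtain u v u' v' where "(u, v) \<in> D" "(u', v') \<in> D" "p = (f u, f v)" "p' = (f u', f v')"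
          by (auto simp: image_iff)
        moreover from this have "(u, v) \<noteq> (u', v')"
          using \<open>p \<noteq> p'\<close> by auto
        ultimately show "(case p of (u, v) \<Rightarrow> {u<..<v}) \<inter> (case p' of (u, v) \<Rightarrow> {u<..<v}) = {}"
          by (simp only: prod.case disj not_False_eq_True)
      qed
      then show "nonoverlapping_in l' r' (map_prod f f ` D)"
        using D(1) bounds by (auto simp: nonoverlapping_in_def)
      have "(\<Sum>(u, v)\<in>map_prod f f ` D. v - u) \<le> (\<Sum>(u, v)\<in>D. \<bar>f v - f u\<bar>)"
        by (simp add: sum.reindex[OF inj] case_prod_unfold sum_mono)
      also have "\<dots> < \<eta>"
        using nonoverlap small by (rule \<delta>)
      finally show "(\<Sum>(u, v)\<in>map_prod f f ` D. v - u) < \<eta>" .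
    qed
    then show ?thesis
      by (simp add: sum.reindex[OF inj] case_prod_unfold)
  qed
  with \<open>\<delta> > 0\<close> show "\<exists>\<delta>>0. \<forall>D. nonoverlapping_in l r D \<longrightarrow> (\<Sum>(u, v)\<in>D. v - u) < \<delta>
      \<longrightarrow> (\<Sum>(u, v)\<in>D. \<bar>(x \<circ> f) v - (x \<circ> f) u\<bar>) < \<epsilon>"
    by blast
qed

section \<open>Null sets under a change of variable\<close>

lemma AE_lebesgue_on_iff_negligible:
  assumes "S \<in> sets lebesgue"
  shows "(AE t in lebesgue_on S. P t) \<longleftrightarrow> negligible {t \<in> S. \<not> P t}"
proof -
  have "(AE t in lebesgue_on S. P t) \<longleftrightarrow> (AE t in lebesgue. t \<in> S \<longrightarrow> P t)"
    using assms by (simp add: AE_restrict_space_iff)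
  also have "\<dots> \<longleftrightarrow> (AE t in lebesgue. t \<notin> {t \<in> S. \<not> P t})"
    by (auto intro: AE_cong)
  \<comment> \<open>Subsets of negligible sets are negligible, so the exceptional set itself can
    serve as the null set, whether or not \<open>P\<close> is measurable.\<close>
  also have "\<dots> \<longleftrightarrow> negligible {t \<in> S. \<not> P t}"
    unfolding eventually_ae_filter_negligible by (auto intro: negligible_subset)
  finally show ?thesis .
qed

text \<open>The two exceptional sets are images of each other under \<open>f\<close> and
  \<open>g\<close>, and a differentiable map of a Euclidean space into itself sends negligible sets
  to negligible sets.\<close>

lemma AE_lebesgue_on_differentiable_image_iff:
  fixes f g :: "'a::euclidean_space \<Rightarrow> 'a"
  assumes f: "f ` S = T" "f differentiable_on S"
    and g: "g differentiable_on T" "\<And>s. s \<in> S \<Longrightarrow> g (f s) = s"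
    and "S \<in> sets lebesgue" "T \<in> sets lebesgue"
    and PQ: "\<And>s. s \<in> S \<Longrightarrow> P (f s) \<longleftrightarrow> Q s"
  shows "(AE t in lebesgue_on T. P t) \<longleftrightarrow> (AE s in lebesgue_on S. Q s)"
proof -
  have bad_T: "{t \<in> T. \<not> P t} = f ` {s \<in> S. \<not> Q s}"
    using PQ f(1) by auto
  have bad_S: "{s \<in> S. \<not> Q s} = g ` {t \<in> T. \<not> P t}"
    using g(2) by (force simp: bad_T image_image)
  have "negligible {t \<in> T. \<not> P t} \<longleftrightarrow> negligible {s \<in> S. \<not> Q s}"
  proof
    assume "negligible {t \<in> T. \<not> P t}"
    then show "negligible {s \<in> S. \<not> Q s}"
      unfolding bad_S
      by (intro negligible_differentiable_image_negligible differentiable_on_subset[OF g(1)]) auto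
  next
    assume "negligible {s \<in> S. \<not> Q s}"
    then show "negligible {t \<in> T. \<not> P t}"
      unfolding bad_T
      by (intro negligible_differentiable_image_negligible differentiable_on_subset[OF f(2)]) auto
  qed
  then show ?thesis
    using assms(5,6) by (simp add: AE_lebesgue_on_iff_negligible)
qed

section \<open>Transfer of the boundary value problem\<close>

lemma solves_periodic_problem_compose:
  fixes f g x \<phi> \<psi> :: "real \<Rightarrow> real"
  assumes ltlr: "l < r" "l' < r'"
    and f: "strict_mono_on {l..r} f" "f ` {l..r} = {l'..r'}" "f differentiable_on {l..r}"
    and g: "g differentiable_on {l'..r'}" "\<And>s. s \<in> {l..r} \<Longrightarrow> g (f s) = s"
    and \<psi>: "\<psi> ` {l..r} \<subseteq> {l..r}" "\<And>s. s \<in> {l..r} \<Longrightarrow> f (\<psi> s) = \<phi> (f s)"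
  shows "solves_periodic_problem l' r' \<phi> d c b a h x \<longleftrightarrow>
    solves_periodic_problem l r \<psi>
      (\<lambda>s. d (f s) / deriv_within {l..r} f s)
      (\<lambda>s. c (f s) / deriv_within {l..r} f (\<psi> s))
      (\<lambda>s. b (f s)) (\<lambda>s. a (f s)) (\<lambda>s. h (f s))
      (x \<circ> f)"
proof -
  have g_img: "g ` {l'..r'} = {l..r}"
    using g(2) by (force simp flip: f(2))
  \<comment> \<open>The left inverse \<open>g\<close> is two-sided on \<open>{l'..r'}\<close>
    because \<open>f\<close> is onto.\<close>
  have fg: "f (g t) = t" if "t \<in> {l'..r'}" for t
    using that g(2) by (auto simp flip: f(2))
  have g_mono: "strict_mono_on {l'..r'} g"
  proof (rule strict_mono_onI)
    fix t t'
    assume t: "t \<in> {l'..r'}" "t' \<in> {l'..r'}" "t < t'"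
    then have "g t \<in> {l..r}" "g t' \<in> {l..r}"
      using g_img by blast+
    then show "g t < g t'"
      using t fg strict_mono_on_leD[OF f(1), of "g t'" "g t"] by force
  qed
  \<comment> \<open>An increasing surjection matches end points, which turns one periodic boundary
    condition into the other.\<close>
  have ends: "f l = l'" "f r = r'"
  proof -
    have "l' \<in> f ` {l..r}" "r' \<in> f ` {l..r}"
      using f(2) ltlr(2) by auto
    then obtain s s' where s: "s \<in> {l..r}" "f s = l'" "s' \<in> {l..r}" "f s' = r'"
      by auto
    have "f l \<in> {l'..r'}" "f r \<in> {l'..r'}"
      using ltlr(1) by (auto simp flip: f(2))
    moreover have "f l \<le> f s" "f s' \<le> f r"
      using s(1,3) strict_mono_on_leD[OF f(1)] by auto
    ultimately show "f l = l'" "f r = r'"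
      using s(2,4) by auto
  qed
  have ac: "absolutely_continuous_fun l' r' x \<longleftrightarrow> absolutely_continuous_fun l r (x \<circ> f)"
  proof
    assume "absolutely_continuous_fun l' r' x"
    then show "absolutely_continuous_fun l r (x \<circ> f)"
      using absolutely_continuous_fun_compose[OF f(1,2)] ltlr(1) f(1,3)
      by (simp add: absolutely_continuous_fun_mono_differentiable strict_mono_on_imp_mono_on)
  next
    assume "absolutely_continuous_fun l r (x \<circ> f)"
    then have "absolutely_continuous_fun l' r' (x \<circ> f \<circ> g)"
      using absolutely_continuous_fun_compose[OF g_mono g_img] ltlr(2) g_mono g(1)
      by (simp add: absolutely_continuous_fun_mono_differentiable strict_mono_on_imp_mono_on)
    \<comment> \<open>As total functions, \<open>x \<circ> f \<circ> g\<close> and \<open>x\<close>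
      are only known to agree on the interval, hence the congruence.\<close>
    moreover have "absolutely_continuous_fun l' r' (x \<circ> f \<circ> g) \<longleftrightarrow> absolutely_continuous_fun l' r' x"
      by (rule absolutely_continuous_fun_cong) (simp add: fg)
    ultimately show "absolutely_continuous_fun l' r' x"
      by simp
  qed
  have f_der: "(f has_vector_derivative deriv_within {l..r} f s) (at s within {l..r})"
    if "s \<in> {l..r}" for s
    using f(3) that by (simp add: differentiable_on_def flip: vector_derivative_works)
  have g_der: "(g has_vector_derivative deriv_within {l'..r'} g t) (at t within {l'..r'})"
    if "t \<in> {l'..r'}" for t
    using g(1) that by (simp add: differentiable_on_def flip: vector_derivative_works)
  \<comment> \<open>A zero of the derivative would give \<open>g \<circ> f\<close> the derivative 0,
    yet it is the identity on the interval. This rules out division by zero, which would silently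
    yield 0 in the coefficients.\<close>
  have f_der_nz: "deriv_within {l..r} f s \<noteq> 0" if s: "s \<in> {l..r}" for s
  proof
    assume "deriv_within {l..r} f s = 0"
    moreover have "f s \<in> {l'..r'}"
      using s by (auto simp flip: f(2))
    ultimately have "((g \<circ> f) has_vector_derivative 0) (at s within {l..r})"
      using vector_diff_chain_within[OF f_der[OF s], of g] g_der[of "f s"] f(2) by simp
    moreover have "((g \<circ> f) has_vector_derivative 1) (at s within {l..r})"
      using s g(2)
      by (intro has_vector_derivative_transform[OF s, of "g \<circ> f" "\<lambda>s. s"]) (auto intro: derivative_intros)
    ultimately show False
      using vector_derivative_within_cbox[OF ltlr(1)] s by (metis cbox_interval zero_neq_one)
  qed
  \<comment> \<open>Differentiability is part of the equation, so it must transfer both ways; the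
    converse applies the chain rule to \<open>x \<circ> f\<close> and \<open>g\<close>.\<close>
  have x_diff: "x differentiable (at (f s) within {l'..r'}) \<longleftrightarrow> (x \<circ> f) differentiable (at s within {l..r})"
    if s: "s \<in> {l..r}" for s
  proof
    assume "x differentiable (at (f s) within {l'..r'})"
    then show "(x \<circ> f) differentiable (at s within {l..r})"
      using f(2,3) s by (intro differentiable_chain_within) (auto simp: differentiable_on_def)
  next
    assume "(x \<circ> f) differentiable (at s within {l..r})"
    moreover have fs: "f s \<in> {l'..r'}"
      using s by (auto simp flip: f(2))
    ultimately have "(x \<circ> f \<circ> g) differentiable (at (f s) within {l'..r'})"
      using differentiable_chain_within[of g "f s" "{l'..r'}" "x \<circ> f"] g g_img s
      by (simp add: differentiable_on_def)
    then show "x differentiable (at (f s) within {l'..r'})"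
      by (rule differentiable_transform_within[OF _ zero_less_one fs]) (simp add: fg)
  qed
  have x_der: "deriv_within {l..r} (x \<circ> f) s = deriv_within {l..r} f s * deriv_within {l'..r'} x (f s)"
    if s: "s \<in> {l..r}" and "x differentiable (at (f s) within {l'..r'})" for s
  proof -
    have "((x \<circ> f) has_vector_derivative
        deriv_within {l..r} f s *\<^sub>R deriv_within {l'..r'} x (f s)) (at s within {l..r})"
      using that f(2) by (intro vector_diff_chain_within f_der) (auto simp flip: vector_derivative_works)
    then show ?thesis
      using vector_derivative_within_cbox[OF ltlr(1)] s by (metis cbox_interval real_scaleR_def)
  qed
  let ?P = "\<lambda>t. x differentiable (at t within {l'..r'})
      \<and> x differentiable (at (\<phi> t) within {l'..r'})
      \<and> d t * deriv_within {l'..r'} x t + c t * deriv_within {l'..r'} x (\<phi> t)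
          + b t * x t + a t * x (\<phi> t) = h t"
  let ?Q = "\<lambda>s. (x \<circ> f) differentiable (at s within {l..r})
      \<and> (x \<circ> f) differentiable (at (\<psi> s) within {l..r})
      \<and> d (f s) / deriv_within {l..r} f s * deriv_within {l..r} (x \<circ> f) s
          + c (f s) / deriv_within {l..r} f (\<psi> s) * deriv_within {l..r} (x \<circ> f) (\<psi> s)
          + b (f s) * (x \<circ> f) s + a (f s) * (x \<circ> f) (\<psi> s) = h (f s)"
  \<comment> \<open>The chain rule factors at \<open>s\<close> and at \<open>\<psi> s\<close> cancel
    the denominators of the coefficients, and \<open>f (\<psi> s) = \<phi> (f s)\<close> matches the
    reflected arguments.\<close>
  have PQ: "?P (f s) \<longleftrightarrow> ?Q s" if s: "s \<in> {l..r}" for s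
  proof -
    have \<psi>s: "\<psi> s \<in> {l..r}"
      using \<psi>(1) s by blast
    show ?thesis
      using x_diff[OF s] x_diff[OF \<psi>s] x_der[OF s] x_der[OF \<psi>s] f_der_nz[OF s] f_der_nz[OF \<psi>s] \<psi>(2)[OF s]
      by auto
  qed
  have "(AE t in lebesgue_on {l'..r'}. ?P t) \<longleftrightarrow> (AE s in lebesgue_on {l..r}. ?Q s)"
  proof (rule AE_lebesgue_on_differentiable_image_iff[OF f(2,3) g, where P = ?P and Q = ?Q])
    show "{l..r} \<in> sets lebesgue" "{l'..r'} \<in> sets lebesgue"
      by simp_all
    show "?P (f s) \<longleftrightarrow> ?Q s" if "s \<in> {l..r}" for s
      using that by (rule PQ)
  qed
  then show ?thesis
    unfolding solves_periodic_problem_def by (simp only: ac ends o_apply)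
qed

theorem mainTheorem4:
  fixes \<tau>1 \<tau>2 \<sigma>1 \<sigma>2 :: real
    and \<phi> \<psi> f a b c d h :: "real \<Rightarrow> real"
  assumes "\<tau>1 < \<tau>2" and "\<sigma>1 < \<sigma>2"
    and "involution_on {\<tau>1..\<tau>2} \<phi>" and "\<phi> differentiable_on {\<tau>1..\<tau>2}"
    and "involution_on {\<sigma>1..\<sigma>2} \<psi>" and "\<psi> differentiable_on {\<sigma>1..\<sigma>2}"
    and "diffeomorphism_on {\<sigma>1..\<sigma>2} {\<tau>1..\<tau>2} f" and "strict_mono_on {\<sigma>1..\<sigma>2} f"
    and "\<forall>s\<in>{\<sigma>1..\<sigma>2}. f (\<psi> s) = \<phi> (f s)"
    and "a absolutely_integrable_on {\<tau>1..\<tau>2}"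
    and "b absolutely_integrable_on {\<tau>1..\<tau>2}"
    and "c absolutely_integrable_on {\<tau>1..\<tau>2}"
    and "d absolutely_integrable_on {\<tau>1..\<tau>2}"
  shows "\<forall>x :: real \<Rightarrow> real.
    solves_periodic_problem \<tau>1 \<tau>2 \<phi> d c b a h x \<longleftrightarrow>
    solves_periodic_problem \<sigma>1 \<sigma>2 \<psi>
      (\<lambda>s. d (f s) / deriv_within {\<sigma>1..\<sigma>2} f s)
      (\<lambda>s. c (f s) / deriv_within {\<sigma>1..\<sigma>2} f (\<psi> s))
      (\<lambda>s. b (f s)) (\<lambda>s. a (f s)) (\<lambda>s. h (f s))
      (x \<circ> f)"
proof
  fix x :: "real \<Rightarrow> real"
  have f_img: "f ` {\<sigma>1..\<sigma>2} = {\<tau>1..\<tau>2}" and inj: "inj_on f {\<sigma>1..\<sigma>2}"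
    and f: "f differentiable_on {\<sigma>1..\<sigma>2}" and g: "inv_into {\<sigma>1..\<sigma>2} f differentiable_on {\<tau>1..\<tau>2}"
    using assms(7) by (auto simp: diffeomorphism_on_def bij_betw_def)
  show "solves_periodic_problem \<tau>1 \<tau>2 \<phi> d c b a h x \<longleftrightarrow>
    solves_periodic_problem \<sigma>1 \<sigma>2 \<psi>
      (\<lambda>s. d (f s) / deriv_within {\<sigma>1..\<sigma>2} f s)
      (\<lambda>s. c (f s) / deriv_within {\<sigma>1..\<sigma>2} f (\<psi> s))
      (\<lambda>s. b (f s)) (\<lambda>s. a (f s)) (\<lambda>s. h (f s))
      (x \<circ> f)"
    \<comment> \<open>Here \<open>inv_into\<close> plays the part of \<open>g\<close>, a left
      inverse by injectivity, and the involution \<open>\<psi>\<close> maps its interval into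
      itself.\<close>
    using assms(5,9) inj
    by (intro solves_periodic_problem_compose[OF assms(2,1,8) f_img f g])
      (auto simp: involution_on_def)
qed

end
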